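(* Let $P$ be a submonoid of a group $G$. Suppose $w\colon P\to B$ is a map from $P$ to a $\mathrm C^*$-algebra $B$ such that (T1) $w_e=1$; (T2) $\dot w_\alpha=0$ if $K(\alpha)=\emptyset$ with $\dot\alpha=e$; and (T3) $\dot w_\alpha=\dot w_\beta$ if $\alpha$ and $\beta$ are neutral words in $\mathcal W$ such that $K(\alpha)=K(\beta)$. Then $w$ also has the following properties: (1) $w_p$ is an isometry for all $p\in P$; (2) $w_pw_q=w_{pq}$ for all $p,q\in P$; (3) the set $\{\dot w_\alpha:\alpha\in\mathcal W,\ \dot\alpha=e\}$ does not depend on the embedding $P\hookrightarrow G$ and is a commuting family of projections that is closed under multiplication and contains the identity; and (4) if $F$ is a finite set of neutral words in $\mathcal W$ with $\bigcup_{\beta\in F}K(\beta)=K(\alpha)$ for some neutral word $\alpha\in\mathcal W$ such that $K(\alpha)\in\{K(\beta):\beta\in F\}$, then $$\dot w_\alpha=\sum_{\emptyset\neq A\subset F}(-1)^{|A|+1}\prod_{\beta\in A}\dot w_\beta.$$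
   Context: $e$ is the identity of $G$. A word is a finite sequence $\alpha=(p_1,p_2,\ldots,p_{2k-1},p_{2k})$ of even length $2k\ge 0$ with entries in $P$; $\mathcal W$ is the set of all words (including the empty word). Put $\dot\alpha:=p_1^{-1}p_2\cdots p_{2k-1}^{-1}p_{2k}\in G$ (equal to $e$ for the empty word); $\alpha$ is neutral if $\dot\alpha=e$. Put $K(\alpha):=P\cap p_{2k}^{-1}p_{2k-1}P\cap p_{2k}^{-1}p_{2k-1}p_{2k-2}^{-1}p_{2k-3}P\cap\cdots\cap p_{2k}^{-1}p_{2k-1}\cdots p_2^{-1}p_1P\subseteq P$ (equal to $P$ for the empty word). For a map $w\colon P\to B$ into a (unital) $\mathrm C^*$-algebra, $\dot w_\alpha:=w_{p_1}^*w_{p_2}\cdots w_{p_{2k-1}}^*w_{p_{2k}}\in B$ ($=1$ for the empty word). As subsets of $P$, the sets $K(\alpha)$ do not depend on the group in which $P$ is embedded, though which words are neutral may; (3) says the resulting set of elements is the same for any embedding of $P$ in a group. *)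

theory Defs
  imports Complex_Main "HOL-Algebra.Coset" "HOL-Algebra.Elementary_Groups"
begin

section \<open>Unital $C^*$-algebras\<close>

text \<open>
  The unit is taken from \<^class>\<open>monoid_mult\<close> and not from \<^class>\<open>ring_1\<close> or
  \<^class>\<open>real_normed_algebra_1\<close>, so that the zero algebra is not excluded. If \<open>1 \<noteq> 0\<close>, then
  \<open>norm 1 = 1\<close> follows from the $C^*$-identity.
\<close>

class unital_cstar_algebra = real_normed_algebra + banach + monoid_mult +
  fixes scaleC :: "complex \<Rightarrow> 'a \<Rightarrow> 'a"
    and adj :: "'a \<Rightarrow> 'a"
  assumes scaleC_add_right: "scaleC a (x + y) = scaleC a x + scaleC a y"
    and scaleC_add_left: "scaleC (a + b) x = scaleC a x + scaleC b x"
    and scaleC_scaleC: "scaleC a (scaleC b x) = scaleC (a * b) x"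
    and scaleC_of_real: "scaleC (complex_of_real r) x = scaleR r x"
    and mult_scaleC_left: "scaleC a x * y = scaleC a (x * y)"
    and mult_scaleC_right: "x * scaleC a y = scaleC a (x * y)"
    and norm_scaleC: "norm (scaleC a x) = cmod a * norm x"
    and adj_adj: "adj (adj x) = x"
    and adj_add: "adj (x + y) = adj x + adj y"
    and adj_scaleC: "adj (scaleC a x) = scaleC (cnj a) (adj x)"
    and adj_mult: "adj (x * y) = adj y * adj x"
    and cstar_identity: "norm (adj x * x) = norm x ^ 2"

definition is_isometry :: "'b::unital_cstar_algebra \<Rightarrow> bool" where
  "is_isometry v \<longleftrightarrow> adj v * v = 1"

definition is_projection :: "'b::unital_cstar_algebra \<Rightarrow> bool" where
  "is_projection x \<longleftrightarrow> adj x = x \<and> x * x = x"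

text \<open>
  The library's \<^const>\<open>prod\<close> needs a commutative type. For a finite set \<open>A\<close>, the following is the
  product of the \<open>f a\<close> in any order whenever these elements commute pairwise; it is not meaningful
  otherwise.
\<close>

definition commuting_prod :: "('i \<Rightarrow> 'b::monoid_mult) \<Rightarrow> 'i set \<Rightarrow> 'b" where
  "commuting_prod f A = Finite_Set.fold (\<lambda>a x. f a * x) 1 A"


section \<open>Words\<close>

definition words :: "'g set \<Rightarrow> 'g list set" where
  "words P = {\<alpha>. set \<alpha> \<subseteq> P \<and> even (length \<alpha>)}"

text \<open>
  The functions below peel off two letters at a time. They are only meant for lists of even length
  and are unspecified on the others.
\<close>

text \<open>$\dot\alpha = p_1^{-1} p_2 \cdots p_{2k-1}^{-1} p_{2k}$\<close>

fun word_val :: "('g, 'm) monoid_scheme \<Rightarrow> 'g list \<Rightarrow> 'g" where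
  "word_val G [] = \<one>\<^bsub>G\<^esub>"
| "word_val G (p # q # \<alpha>) = inv\<^bsub>G\<^esub> p \<otimes>\<^bsub>G\<^esub> q \<otimes>\<^bsub>G\<^esub> word_val G \<alpha>"

text \<open>$p_{2k}^{-1} p_{2k-1} \cdots p_2^{-1} p_1$\<close>

fun word_rev_val :: "('g, 'm) monoid_scheme \<Rightarrow> 'g list \<Rightarrow> 'g" where
  "word_rev_val G [] = \<one>\<^bsub>G\<^esub>"
| "word_rev_val G (p # q # \<alpha>) = word_rev_val G \<alpha> \<otimes>\<^bsub>G\<^esub> inv\<^bsub>G\<^esub> q \<otimes>\<^bsub>G\<^esub> p"

text \<open>
  $K(\alpha) = P \cap p_{2k}^{-1} p_{2k-1} P \cap \cdots \cap p_{2k}^{-1} p_{2k-1} \cdots p_2^{-1} p_1 P$;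
  each suffix of even length contributes one translate of \<open>P\<close>.
\<close>

fun K :: "('g, 'm) monoid_scheme \<Rightarrow> 'g set \<Rightarrow> 'g list \<Rightarrow> 'g set" where
  "K G P [] = P"
| "K G P (p # q # \<alpha>) = K G P \<alpha> \<inter> (word_rev_val G (p # q # \<alpha>) <#\<^bsub>G\<^esub> P)"

text \<open>$\dot w_\alpha = w_{p_1}^* w_{p_2} \cdots w_{p_{2k-1}}^* w_{p_{2k}}$\<close>

fun wdot :: "('g \<Rightarrow> 'b::unital_cstar_algebra) \<Rightarrow> 'g list \<Rightarrow> 'b" where
  "wdot w [] = 1"
| "wdot w (p # q # \<alpha>) = adj (w p) * w q * wdot w \<alpha>"

definition neutral_words :: "('g, 'm) monoid_scheme \<Rightarrow> 'g set \<Rightarrow> 'g list set" where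
  "neutral_words G P = {\<alpha> \<in> words P. word_val G \<alpha> = \<one>\<^bsub>G\<^esub>}"

text \<open>
  The words in \<open>P\<close> that are neutral with respect to a map \<open>j\<close> of \<open>P\<close> into another group \<open>H\<close>.
\<close>

definition neutral_words_via ::
    "('h, 'n) monoid_scheme \<Rightarrow> ('g \<Rightarrow> 'h) \<Rightarrow> 'g set \<Rightarrow> 'g list set" where
  "neutral_words_via H j P = {\<alpha> \<in> words P. word_val H (map j \<alpha>) = \<one>\<^bsub>H\<^esub>}"

text \<open>
  Embeddings of the monoid \<open>P\<close> in a group. Preservation of the identity need not be required:
  the image of the identity is idempotent.
\<close>

definition embeddings ::
    "('g, 'm) monoid_scheme \<Rightarrow> 'g set \<Rightarrow> ('h, 'n) monoid_scheme \<Rightarrow> ('g \<Rightarrow> 'h) set" where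
  "embeddings G P H = mon (G\<lparr>carrier := P\<rparr>) H"

end

theory Submission
  imports Defs
begin

text \<open>
  A word \<open>\<alpha>\<close> acts on \<open>P\<close> as a partial translation: \<open>K(\<alpha>)\<close> is the set of those \<open>t\<close> for which all
  partial products \<open>p\<^sub>2\<^sub>i\<^sub>-\<^sub>1\<^sup>-\<^sup>1 p\<^sub>2\<^sub>i \<dots> p\<^sub>2\<^sub>k t\<close> stay in \<open>P\<close>. Reversing \<open>\<alpha>\<close> inverts this
  translation and concatenation composes it, so that for neutral words reversal preserves
  \<open>K\<close> and concatenation intersects it; (T3) turns this into self-adjointness, idempotence and
  commutation. For (2), the words \<open>(q,e,p,pq)\<close> and \<open>(pq,p,e,q)\<close> are neutral with \<open>K = P\<close>, so
  \<open>d = w\<^sub>p w\<^sub>q - w\<^sub>p\<^sub>q\<close> satisfies \<open>d\<^sup>* d = 1 - 1 - 1 + 1 = 0\<close>.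

  For the independence of the embedding: if \<open>t \<in> K(\<alpha>)\<close>, then \<open>\<alpha>\<close> is neutral iff the translation
  fixes \<open>t\<close>, which does not refer to the ambient group. If \<open>K(\<alpha>)\<close> is empty, then \<open>\<alpha>\<close> followed by
  its reverse is neutral in every group and has empty \<open>K\<close>, hence \<open>w\<^sub>\<alpha> w\<^sub>\<alpha>\<^sup>* = 0\<close> and
  \<open>w\<^sub>\<alpha> = 0\<close>.

  In (4), the projection of a \<open>\<beta>\<^sub>0 \<in> F\<close> with \<open>K(\<beta>\<^sub>0) = K(\<alpha>)\<close> dominates all the others, and the terms
  for \<open>A\<close> and \<open>A \<union> {\<beta>\<^sub>0}\<close> cancel unless \<open>A\<close> is empty.
\<close>

section \<open>The involution of a unital C*-algebra\<close>

lemma adj_one: "adj (1 :: 'a::unital_cstar_algebra) = 1"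
  by (metis adj_adj adj_mult mult_1_right)

lemma adj_diff: "adj (x - y) = adj x - adj (y :: 'a::unital_cstar_algebra)"
  by (metis adj_add add_diff_cancel diff_add_cancel)

lemma adj_mult_self_eq_0_iff: "adj x * x = 0 \<longleftrightarrow> x = (0 :: 'a::unital_cstar_algebra)"
  by (metis cstar_identity mult_zero_right norm_eq_zero power_eq_0_iff)

lemma mult_adj_self_eq_0_iff: "x * adj x = 0 \<longleftrightarrow> x = (0 :: 'a::unital_cstar_algebra)"
proof -
  have "adj (0 :: 'a) = 0"
    using adj_diff[of "0 :: 'a" 0] by simp
  then have "adj x = 0 \<longleftrightarrow> x = 0"
    using adj_adj[of x] by auto
  then show ?thesis
    using adj_mult_self_eq_0_iff[of "adj x"] by (simp add: adj_adj)
qed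

section \<open>Words and their operators\<close>

lemma wdot_append: "even (length \<alpha>) \<Longrightarrow> wdot w (\<alpha> @ \<beta>) = wdot w \<alpha> * wdot w \<beta>"
  by (induction \<alpha> rule: induct_list012) (auto simp: mult.assoc)

text \<open>In a list of even length, reversal exchanges the starred and the unstarred positions, as
  the adjoint does.\<close>

lemma wdot_rev: "even (length \<alpha>) \<Longrightarrow> wdot w (rev \<alpha>) = adj (wdot w \<alpha>)"
  by (induction \<alpha> rule: induct_list012) (auto simp: wdot_append adj_one adj_mult adj_adj mult.assoc)

lemma even_length_if_words: "\<alpha> \<in> words P \<Longrightarrow> even (length \<alpha>)"
  by (simp add: words_def)

lemma append_in_words: "\<alpha> \<in> words P \<Longrightarrow> \<beta> \<in> words P \<Longrightarrow> \<alpha> @ \<beta> \<in> words P"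
  by (simp add: words_def)

lemma rev_in_words: "\<alpha> \<in> words P \<Longrightarrow> rev \<alpha> \<in> words P"
  by (simp add: words_def)

lemma map_in_words: "\<alpha> \<in> words P \<Longrightarrow> j ` P \<subseteq> Q \<Longrightarrow> map j \<alpha> \<in> words Q"
  by (auto simp: words_def)

lemma words_mono: "\<alpha> \<in> words P \<Longrightarrow> P \<subseteq> Q \<Longrightarrow> \<alpha> \<in> words Q"
  by (auto simp: words_def)

lemma words_Cons_Cons_iff: "p # q # \<alpha> \<in> words P \<longleftrightarrow> p \<in> P \<and> q \<in> P \<and> \<alpha> \<in> words P"
  by (auto simp: words_def)

lemma K_subset: "even (length \<alpha>) \<Longrightarrow> K G P \<alpha> \<subseteq> P"
  by (induction \<alpha> rule: induct_list012) auto

section \<open>Words as partial translations of \<open>P\<close>\<close>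

context group
begin

lemma word_val_closed: "\<alpha> \<in> words (carrier G) \<Longrightarrow> word_val G \<alpha> \<in> carrier G"
  by (induction \<alpha> rule: induct_list012) (auto simp: words_def)

lemma word_val_append:
  "\<alpha> \<in> words (carrier G) \<Longrightarrow> \<beta> \<in> words (carrier G) \<Longrightarrow>
    word_val G (\<alpha> @ \<beta>) = word_val G \<alpha> \<otimes> word_val G \<beta>"
proof (induction \<alpha> rule: induct_list012)
  case (3 p q \<alpha>)
  then show ?case
    by (simp add: words_Cons_Cons_iff m_assoc word_val_closed)
qed (auto simp: words_def word_val_closed)

lemma word_val_rev: "\<alpha> \<in> words (carrier G) \<Longrightarrow> word_val G (rev \<alpha>) = inv word_val G \<alpha>"
proof (induction \<alpha> rule: induct_list012)
  case (3 p q \<alpha>)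
  moreover have "rev \<alpha> \<in> words (carrier G)" "[q, p] \<in> words (carrier G)"
    using 3 by (auto simp: words_def)
  ultimately show ?case
    by (simp add: words_Cons_Cons_iff word_val_append word_val_closed inv_mult_group m_assoc)
qed (auto simp: words_def)

lemma word_rev_val_eq: "\<alpha> \<in> words (carrier G) \<Longrightarrow> word_rev_val G \<alpha> = inv word_val G \<alpha>"
  by (induction \<alpha> rule: induct_list012)
     (auto simp: words_def word_val_closed inv_mult_group m_assoc)

lemma mem_inv_l_coset_iff:
  assumes "P \<subseteq> carrier G" "g \<in> carrier G" "t \<in> carrier G"
  shows "t \<in> inv g <# P \<longleftrightarrow> g \<otimes> t \<in> P"
proof
  assume "t \<in> inv g <# P"
  then obtain s where "s \<in> P" "t = inv g \<otimes> s"
    by (auto simp: l_coset_def)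
  with assms show "g \<otimes> t \<in> P"
    by (auto simp: m_assoc[symmetric])
next
  assume "g \<otimes> t \<in> P"
  moreover have "t = inv g \<otimes> (g \<otimes> t)"
    using assms by (simp add: m_assoc[symmetric])
  ultimately show "t \<in> inv g <# P"
    unfolding l_coset_def by blast
qed

lemma mem_K_Cons_Cons_iff:
  assumes "P \<subseteq> carrier G" "p # q # \<alpha> \<in> words P"
  shows "t \<in> K G P (p # q # \<alpha>) \<longleftrightarrow> t \<in> K G P \<alpha> \<and> word_val G (p # q # \<alpha>) \<otimes> t \<in> P"
proof (cases "t \<in> K G P \<alpha>")
  case True
  with assms have "t \<in> carrier G"
    using K_subset[of \<alpha> G P] by (auto simp: words_def)
  moreover have "p # q # \<alpha> \<in> words (carrier G)"
    using assms words_mono by blast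
  ultimately show ?thesis
    using True assms by (simp only: K.simps word_rev_val_eq mem_inv_l_coset_iff word_val_closed Int_iff)
qed simp

text \<open>This is the domain of a composite of partial maps, with \<beta> acting first because the
  letters nearest the end meet t first.\<close>

lemma mem_K_append_iff:
  assumes P: "P \<subseteq> carrier G" and "\<alpha> \<in> words P" and \<beta>: "\<beta> \<in> words P"
  shows "t \<in> K G P (\<alpha> @ \<beta>) \<longleftrightarrow> t \<in> K G P \<beta> \<and> word_val G \<beta> \<otimes> t \<in> K G P \<alpha>"
  using assms(2)
proof (induction \<alpha> rule: induct_list012)
  case 1
  \<comment> \<open>For empty \<alpha> the claim includes that \<beta> carries t into
    \<open>P\<close>; this is the outermost condition in \<open>K G P \<beta>\<close> and shows only
    once two letters are split off.\<close>
  consider "\<beta> = []" | x where "\<beta> = [x]" | p q \<gamma> where "\<beta> = p # q # \<gamma>"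
    by (metis neq_Nil_conv)
  then show ?case
  proof cases
    case 1
    then show ?thesis using P by auto
  next
    case 2
    with \<beta> show ?thesis by (simp add: words_def)
  next
    case (3 p q \<gamma>)
    then show ?thesis
      using mem_K_Cons_Cons_iff[OF P, of p q \<gamma> t] \<beta> by auto
  qed
next
  case (2 x)
  then show ?case by (simp add: words_def)
next
  case (3 p q \<alpha>)
  let ?\<gamma> = "p # q # \<alpha>"
  have w: "?\<gamma> @ \<beta> \<in> words P" "\<alpha> \<in> words P"
    using 3 \<beta> by (auto simp: words_def)
  have c: "?\<gamma> \<in> words (carrier G)" "\<beta> \<in> words (carrier G)"
    using 3 \<beta> P words_mono by blast+
  have "t \<in> K G P (?\<gamma> @ \<beta>) \<longleftrightarrow>
      t \<in> K G P \<beta> \<and> word_val G \<beta> \<otimes> t \<in> K G P \<alpha> \<and> word_val G (?\<gamma> @ \<beta>) \<otimes> t \<in> P"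
    using mem_K_Cons_Cons_iff[OF P, of p q "\<alpha> @ \<beta>" t] w 3 by auto
  also have "\<dots> \<longleftrightarrow> t \<in> K G P \<beta> \<and> word_val G \<beta> \<otimes> t \<in> K G P ?\<gamma>"
  proof (cases "t \<in> K G P \<beta>")
    case True
    with \<beta> P have "t \<in> carrier G"
      using K_subset[of \<beta> G P] by (auto simp: words_def)
    with c show ?thesis
      using mem_K_Cons_Cons_iff[OF P 3(3)] word_val_append[OF c]
      by (simp add: m_assoc word_val_closed del: K.simps word_val.simps)
  qed simp
  finally show ?case .
qed

text \<open>Reversal inverts the partial translation, so the domain of \<open>rev \<alpha>\<close>
  is the range of \<alpha>. The induction varies t because the last pair of letters of the reversed
  word moves t before the rest acts.\<close>

lemma mem_K_rev_iff:
  assumes P: "P \<subseteq> carrier G" and "\<alpha> \<in> words P" and "t \<in> carrier G"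
  shows "t \<in> K G P (rev \<alpha>) \<longleftrightarrow> word_val G (rev \<alpha>) \<otimes> t \<in> K G P \<alpha>"
  using assms(2,3)
proof (induction \<alpha> arbitrary: t rule: induct_list012)
  case (3 p q \<alpha>)
  let ?\<gamma> = "p # q # \<alpha>"
  \<comment> \<open>The image of t under \<open>[q, p]\<close>, the part of
    \<open>rev (p # q # \<alpha>)\<close> that acts first.\<close>
  define s where "s = inv q \<otimes> p \<otimes> t"
  have w: "\<alpha> \<in> words P" "rev \<alpha> \<in> words P" "[q, p] \<in> words P" "p \<in> P" "q \<in> P"
    using 3 by (auto simp: words_def)
  have c: "\<alpha> \<in> words (carrier G)" "rev \<alpha> \<in> words (carrier G)" "[q, p] \<in> words (carrier G)"
      "p \<in> carrier G" "q \<in> carrier G"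
    using w P words_mono by blast+
  have s: "s \<in> carrier G"
    using c 3 by (simp add: s_def)
  have val: "word_val G (rev ?\<gamma>) \<otimes> t = word_val G (rev \<alpha>) \<otimes> s"
    using c 3 by (simp add: word_val_append s_def m_assoc word_val_closed)
  have t: "word_val G ?\<gamma> \<otimes> (word_val G (rev \<alpha>) \<otimes> s) = t"
  proof -
    have "word_val G \<alpha> \<otimes> (word_val G (rev \<alpha>) \<otimes> s) = s"
      using c s by (simp add: word_val_rev word_val_closed m_assoc[symmetric])
    then have "word_val G ?\<gamma> \<otimes> (word_val G (rev \<alpha>) \<otimes> s) = inv p \<otimes> (q \<otimes> s)"
      using c s by (simp add: m_assoc word_val_closed)
    also have "q \<otimes> s = p \<otimes> t"
      unfolding s_def using c 3 by (simp add: m_assoc[symmetric])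
    finally show ?thesis
      using c 3 by (simp add: m_assoc[symmetric])
  qed
  have "t \<in> K G P (rev ?\<gamma>) \<longleftrightarrow> t \<in> P \<and> s \<in> P \<and> s \<in> K G P (rev \<alpha>)"
    using mem_K_append_iff[OF P w(2,3), of t] mem_K_Cons_Cons_iff[OF P w(3), of t] c
    by (auto simp: s_def simp del: K.simps(2))
  also have "\<dots> \<longleftrightarrow> t \<in> P \<and> s \<in> K G P (rev \<alpha>)"
    using K_subset[of "rev \<alpha>" G P] w by (auto simp: words_def)
  \<comment> \<open>By the fact \<open>t\<close>, the word \<open>p # q # \<alpha>\<close> carries
    the point back to t, so \<open>t \<in> P\<close> is the outermost condition in its
    \<open>K\<close>.\<close>
  also have "\<dots> \<longleftrightarrow> word_val G (rev ?\<gamma>) \<otimes> t \<in> K G P ?\<gamma>"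
    using mem_K_Cons_Cons_iff[OF P 3(3)] 3(1)[OF w(1) s] t val by auto
  finally show ?case .
qed (use P in \<open>auto simp: words_def\<close>)

section \<open>Neutral words\<close>

lemma append_rev_neutral:
  "\<alpha> \<in> words (carrier G) \<Longrightarrow> word_val G (\<alpha> @ rev \<alpha>) = \<one>"
  by (simp add: word_val_append rev_in_words word_val_rev word_val_closed)

lemma rev_in_neutral_words:
  "P \<subseteq> carrier G \<Longrightarrow> \<alpha> \<in> neutral_words G P \<Longrightarrow> rev \<alpha> \<in> neutral_words G P"
  by (auto simp: neutral_words_def rev_in_words word_val_rev words_mono)

lemma append_in_neutral_words:
  "P \<subseteq> carrier G \<Longrightarrow> \<alpha> \<in> neutral_words G P \<Longrightarrow> \<beta> \<in> neutral_words G P \<Longrightarrow>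
    \<alpha> @ \<beta> \<in> neutral_words G P"
  by (auto simp: neutral_words_def append_in_words word_val_append words_mono)

text \<open>A neutral word translates by the identity, so its domain and range coincide.\<close>

lemma K_rev:
  assumes "P \<subseteq> carrier G" "\<alpha> \<in> neutral_words G P"
  shows "K G P (rev \<alpha>) = K G P \<alpha>"
proof -
  have \<alpha>: "\<alpha> \<in> words P" "word_val G (rev \<alpha>) = \<one>" "even (length \<alpha>)"
    using assms rev_in_neutral_words[OF assms]
    by (auto simp: neutral_words_def even_length_if_words)
  show ?thesis
  proof (rule Set.set_eqI)
    fix t
    show "t \<in> K G P (rev \<alpha>) \<longleftrightarrow> t \<in> K G P \<alpha>"
    proof (cases "t \<in> carrier G")
      case True
      then show ?thesis
        using mem_K_rev_iff[OF assms(1) \<alpha>(1)] \<alpha> by auto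
    next
      case False
      then show ?thesis
        using K_subset[of \<alpha> G P] K_subset[of "rev \<alpha>" G P] \<alpha> assms by auto
    qed
  qed
qed

lemma K_append:
  assumes "P \<subseteq> carrier G" "\<alpha> \<in> neutral_words G P" "\<beta> \<in> neutral_words G P"
  shows "K G P (\<alpha> @ \<beta>) = K G P \<alpha> \<inter> K G P \<beta>"
proof -
  have "K G P \<beta> \<subseteq> carrier G"
    using K_subset[of \<beta> G P] assms by (auto simp: neutral_words_def words_def)
  then show ?thesis
    using mem_K_append_iff[OF assms(1), of \<alpha> \<beta>] assms by (auto simp: neutral_words_def)
qed

section \<open>Independence of neutrality from the embedding\<close>

lemma embedding_translate:
  assumes P: "P \<subseteq> carrier G" and H: "group H" and j: "j \<in> embeddings G P H"
    and "\<alpha> \<in> words P" "t \<in> K G P \<alpha>"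
  shows "word_val G \<alpha> \<otimes> t \<in> P \<and>
    j (word_val G \<alpha> \<otimes> t) = word_val H (map j \<alpha>) \<otimes>\<^bsub>H\<^esub> j t"
  using assms(4,5)
proof (induction \<alpha> rule: induct_list012)
  case 1
  interpret H: group H by fact
  show ?case
    using 1 subsetD[OF P, of t] j by (auto simp: embeddings_def mon_def hom_def Pi_iff)
next
  case (2 x)
  then show ?case by (simp add: words_def)
next
  case (3 p q \<alpha>)
  interpret H: group H by fact
  have jc: "\<And>x. x \<in> P \<Longrightarrow> j x \<in> carrier H"
    and jm: "\<And>x y. x \<in> P \<Longrightarrow> y \<in> P \<Longrightarrow> j (x \<otimes> y) = j x \<otimes>\<^bsub>H\<^esub> j y"
    using j by (auto simp: embeddings_def mon_def hom_def)
  define s where "s = word_val G \<alpha> \<otimes> t"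
  define u where "u = word_val G (p # q # \<alpha>) \<otimes> t"
  have w: "\<alpha> \<in> words P" "p \<in> P" "q \<in> P" and t: "t \<in> K G P \<alpha>" and u: "u \<in> P"
    using 3(3) 3(4) mem_K_Cons_Cons_iff[OF P 3(3), of t] unfolding u_def words_Cons_Cons_iff
    by auto
  have c: "\<alpha> \<in> words (carrier G)" "p \<in> carrier G" "q \<in> carrier G"
    using w P words_mono by blast+
  have tP: "t \<in> P"
    using t K_subset[of \<alpha> G P] w by (auto simp: words_def)
  have IH: "s \<in> P" "j s = word_val H (map j \<alpha>) \<otimes>\<^bsub>H\<^esub> j t"
    using 3(1)[OF w(1) t] by (auto simp: s_def)
  have "u = inv p \<otimes> (q \<otimes> s)"
    using c tP P by (auto simp: u_def s_def m_assoc word_val_closed)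
  moreover have "s \<in> carrier G"
    using IH P by blast
  \<comment> \<open>The map j is multiplicative only on \<open>P\<close>, where p has in general no
    inverse; moving p to the left side gives an equation between products of elements of
    \<open>P\<close>.\<close>
  ultimately have "p \<otimes> u = q \<otimes> s"
    using c by (simp add: m_assoc[symmetric])
  then have "j p \<otimes>\<^bsub>H\<^esub> j u = j q \<otimes>\<^bsub>H\<^esub> j s"
    using jm w u IH by metis
  moreover have "j u = inv\<^bsub>H\<^esub> j p \<otimes>\<^bsub>H\<^esub> (j p \<otimes>\<^bsub>H\<^esub> j u)"
    using jc w u by (simp add: H.m_assoc[symmetric])
  ultimately have "j u = inv\<^bsub>H\<^esub> j p \<otimes>\<^bsub>H\<^esub> (j q \<otimes>\<^bsub>H\<^esub> j s)"
    by simp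
  moreover have "word_val H (map j \<alpha>) \<in> carrier H"
    using w jc by (intro H.word_val_closed map_in_words) auto
  ultimately have "j u = word_val H (map j (p # q # \<alpha>)) \<otimes>\<^bsub>H\<^esub> j t"
    using jc w tP IH by (simp add: H.m_assoc)
  with u show ?case by (simp add: u_def)
qed

text \<open>Cancellation makes neutrality equivalent to fixing a single point t of
  \<open>K G P \<alpha>\<close>, and injectivity of j on \<open>P\<close> carries this condition to
  \<open>H\<close> and back.\<close>

lemma neutral_via_iff:
  assumes P: "P \<subseteq> carrier G" and H: "group H" and j: "j \<in> embeddings G P H"
    and \<alpha>: "\<alpha> \<in> words P" and ne: "K G P \<alpha> \<noteq> {}"
  shows "word_val H (map j \<alpha>) = \<one>\<^bsub>H\<^esub> \<longleftrightarrow> word_val G \<alpha> = \<one>"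
proof -
  interpret H: group H by fact
  have jc: "j ` P \<subseteq> carrier H" and inj: "inj_on j P"
    using j by (auto simp: embeddings_def mon_def hom_def)
  obtain t where t: "t \<in> K G P \<alpha>"
    using ne by blast
  have tP: "t \<in> P"
    using t K_subset[of \<alpha> G P] \<alpha> by (auto simp: words_def)
  note tr = embedding_translate[OF P H j \<alpha> t]
  have "word_val G \<alpha> = \<one> \<longleftrightarrow> word_val G \<alpha> \<otimes> t = t"
    using word_val_closed[OF words_mono[OF \<alpha> P]] tP P by auto
  also have "\<dots> \<longleftrightarrow> j (word_val G \<alpha> \<otimes> t) = j t"
    using tr tP inj by (auto dest: inj_onD)
  also have "\<dots> \<longleftrightarrow> word_val H (map j \<alpha>) = \<one>\<^bsub>H\<^esub>"
    using tr H.word_val_closed[OF map_in_words[OF \<alpha> jc]] tP jc by auto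
  finally show ?thesis by simp
qed

end

section \<open>Commuting products and inclusion-exclusion\<close>

lemma commuting_prod_insert:
  assumes "finite A" "a \<notin> A"
    and comm: "\<And>x y. x \<in> insert a A \<Longrightarrow> y \<in> insert a A \<Longrightarrow> f x * f y = f y * f x"
  shows "commuting_prod f (insert a A) = f a * commuting_prod f A"
proof -
  interpret comp_fun_commute_on "insert a A" "\<lambda>a x. f a * x"
    by standard (auto simp: fun_eq_iff comm mult.assoc[symmetric])
  show ?thesis
    unfolding commuting_prod_def using assms by (intro fold_insert) auto
qed

text \<open>Commutation brings any factor to the front, where it absorbs b. The empty product is 1,
  so absorption there would force b = 1.\<close>

lemma absorb_commuting_prod:
  assumes "finite A" "A \<noteq> {}"
    and "\<And>x y. x \<in> A \<Longrightarrow> y \<in> A \<Longrightarrow> f x * f y = f y * f x"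
    and "\<And>x. x \<in> A \<Longrightarrow> b * f x = f x"
  shows "b * commuting_prod f A = commuting_prod f A"
proof -
  obtain a where a: "a \<in> A"
    using assms by blast
  have "commuting_prod f (insert a (A - {a})) = f a * commuting_prod f (A - {a})"
    using assms(1,3) a by (intro commuting_prod_insert) auto
  then have "commuting_prod f A = f a * commuting_prod f (A - {a})"
    using a by (simp add: insert_absorb)
  then show ?thesis
    using assms(4)[OF a] by (simp add: mult.assoc[symmetric])
qed

lemma inclusion_exclusion_dominated:
  fixes f :: "'i \<Rightarrow> 'b::unital_cstar_algebra"
  assumes fin: "finite F" and b: "b \<in> F"
    and comm: "\<And>x y. x \<in> F \<Longrightarrow> y \<in> F \<Longrightarrow> f x * f y = f y * f x"
    and dom: "\<And>x. x \<in> F \<Longrightarrow> f b * f x = f x"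
  shows "(\<Sum>A\<in>{A. A \<subseteq> F \<and> A \<noteq> {}}. (- 1) ^ (card A + 1) * commuting_prod f A) = f b"
proof -
  let ?g = "\<lambda>A. (- 1) ^ (card A + 1) * commuting_prod f A"
  let ?N = "{A. A \<subseteq> F - {b} \<and> A \<noteq> {}}"
  \<comment> \<open>The nonempty sets avoiding b are paired with those obtained by adding b;
    \<open>{b}\<close> would be the partner of the empty set, which the sum omits, and so is left
    over.\<close>
  have split: "{A. A \<subseteq> F \<and> A \<noteq> {}} = insert {b} (?N \<union> insert b ` ?N)"
  proof (intro equalityI subsetI)
    fix A
    assume A: "A \<in> {A. A \<subseteq> F \<and> A \<noteq> {}}"
    show "A \<in> insert {b} (?N \<union> insert b ` ?N)"
    proof (cases "b \<in> A \<and> A \<noteq> {b}")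
      case True
      then have "A = insert b (A - {b})" "A - {b} \<in> ?N"
        using A by auto
      then show ?thesis by blast
    qed (use A in auto)
  qed (use b in auto)
  have finN: "finite ?N"
    using fin by simp
  have inj: "inj_on (insert b) ?N"
    by (auto intro!: inj_onI)
  \<comment> \<open>Adding b keeps the product, because \<open>f b\<close> is absorbed, and reverses
    the sign.\<close>
  have cancel: "?g A + ?g (insert b A) = 0" if A: "A \<in> ?N" for A
  proof -
    have finA: "finite A"
      using A fin by (auto intro: finite_subset)
    have "commuting_prod f (insert b A) = f b * commuting_prod f A"
      using A b finA comm by (intro commuting_prod_insert) auto
    also have "\<dots> = commuting_prod f A"
      using A comm dom finA by (intro absorb_commuting_prod) auto
    finally have "commuting_prod f (insert b A) = commuting_prod f A" .
    moreover have "card (insert b A) = Suc (card A)"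
      using A finA by (intro card_insert_disjoint) auto
    ultimately show ?thesis by simp
  qed
  have "commuting_prod f {b} = f b"
    using commuting_prod_insert[of "{}" b f] by (simp add: commuting_prod_def)
  then have single: "?g {b} = f b"
    by simp
  have "sum ?g {A. A \<subseteq> F \<and> A \<noteq> {}} = ?g {b} + sum ?g (?N \<union> insert b ` ?N)"
    unfolding split using finN by (intro sum.insert) auto
  also have "sum ?g (?N \<union> insert b ` ?N) = sum ?g ?N + sum ?g (insert b ` ?N)"
    using finN by (intro sum.union_disjoint) auto
  also have "sum ?g (insert b ` ?N) = (\<Sum>A\<in>?N. ?g (insert b A))"
    using inj by (simp add: sum.reindex)
  also have "sum ?g ?N + (\<Sum>A\<in>?N. ?g (insert b A)) = (\<Sum>A\<in>?N. ?g A + ?g (insert b A))"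
    by (rule sum.distrib[symmetric])
  also have "\<dots> = 0"
    using cancel by (intro sum.neutral) blast
  finally show ?thesis
    using single by simp
qed

text \<open>Every embedding is compared with the inclusion in \<open>G\<close>; the type
  \<open>'h\<close> of the other group is arbitrary, so any two embeddings give the same set. In the
  last clause \<open>commuting_prod\<close> is independent of the order because the operators of
  neutral words commute.\<close>

theorem proposition3p2:
  fixes G :: "('g, 'm) monoid_scheme"
    and P :: "'g set"
    and w :: "'g \<Rightarrow> 'b::unital_cstar_algebra"
  assumes "group G"
    and "submonoid P G"
    and T1: "w \<one>\<^bsub>G\<^esub> = 1"
    and T2: "\<And>\<alpha>. \<alpha> \<in> neutral_words G P \<Longrightarrow> K G P \<alpha> = {} \<Longrightarrow> wdot w \<alpha> = 0"
    and T3: "\<And>\<alpha> \<beta>. \<alpha> \<in> neutral_words G P \<Longrightarrow> \<beta> \<in> neutral_words G P \<Longrightarrow>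
               K G P \<alpha> = K G P \<beta> \<Longrightarrow> wdot w \<alpha> = wdot w \<beta>"
  shows
    "(\<forall>p\<in>P. is_isometry (w p)) \<and>
     (\<forall>p\<in>P. \<forall>q\<in>P. w p * w q = w (p \<otimes>\<^bsub>G\<^esub> q)) \<and>
     (let S = wdot w ` neutral_words G P in
        (\<forall>(H :: ('h, 'n) monoid_scheme) j. group H \<longrightarrow> j \<in> embeddings G P H \<longrightarrow>
           wdot w ` neutral_words_via H j P = S) \<and>
        (\<forall>x\<in>S. is_projection x) \<and>
        (\<forall>x\<in>S. \<forall>y\<in>S. x * y = y * x) \<and>
        (\<forall>x\<in>S. \<forall>y\<in>S. x * y \<in> S) \<and>
        1 \<in> S) \<and>
     (\<forall>F \<alpha>. finite F \<longrightarrow> F \<subseteq> neutral_words G P \<longrightarrow> \<alpha> \<in> neutral_words G P \<longrightarrow>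
        (\<Union>\<beta>\<in>F. K G P \<beta>) = K G P \<alpha> \<longrightarrow> K G P \<alpha> \<in> K G P ` F \<longrightarrow>
        wdot w \<alpha> = (\<Sum>A\<in>{A. A \<subseteq> F \<and> A \<noteq> {}}. (- 1) ^ (card A + 1) * commuting_prod (wdot w) A))"
proof -
  interpret group G by fact
  interpret P: submonoid P G by fact
  let ?N = "neutral_words G P"
  have P: "P \<subseteq> carrier G"
    by (rule P.subset)
  have words: "\<alpha> \<in> words P" if "\<alpha> \<in> ?N" for \<alpha>
    using that by (simp add: neutral_words_def)
  have even: "even (length \<alpha>)" if "\<alpha> \<in> ?N" for \<alpha>
    using words[OF that] by (rule even_length_if_words)
  have Nil: "[] \<in> ?N"
    by (simp add: neutral_words_def words_def)
  have mult: "wdot w \<alpha> * wdot w \<beta> = wdot w (\<alpha> @ \<beta>)" if "\<alpha> \<in> ?N" for \<alpha> \<beta>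
    using even[OF that] by (simp add: wdot_append)
  \<comment> \<open>This compares \<alpha> with the empty word, whose \<open>K\<close> is
    \<open>P\<close> and whose operator is 1; the inclusion of \<open>K G P \<alpha>\<close> in
    \<open>P\<close> is automatic.\<close>
  have K1: "wdot w \<alpha> = 1" if "\<alpha> \<in> ?N" "P \<subseteq> K G P \<alpha>" for \<alpha>
    using T3[OF that(1) Nil] that(2) K_subset[OF even[OF that(1)], of G P] by simp

  \<comment> \<open>Isometries and multiplicativity\<close>
  have isom: "adj (w p) * w p = 1" if p: "p \<in> P" for p
  proof -
    have pc: "p \<in> carrier G"
      using p P by blast
    have N: "[p, p] \<in> ?N"
      using p pc by (simp add: neutral_words_def words_def)
    have "t \<in> K G P [p, p]" if "t \<in> P" for t
      using that P pc p mem_K_Cons_Cons_iff[OF P words[OF N], of t] by (auto simp del: K.simps(2))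
    then show ?thesis
      using K1[OF N] by auto
  qed
  have hom: "w p * w q = w (p \<otimes>\<^bsub>G\<^esub> q)" if p: "p \<in> P" and q: "q \<in> P" for p q
  proof -
    have c: "p \<in> carrier G" "q \<in> carrier G" "p \<otimes>\<^bsub>G\<^esub> q \<in> P"
      using p q P by auto
    have val: "inv\<^bsub>G\<^esub> (p \<otimes>\<^bsub>G\<^esub> q) \<otimes>\<^bsub>G\<^esub> p \<otimes>\<^bsub>G\<^esub> q = \<one>\<^bsub>G\<^esub>"
      "inv\<^bsub>G\<^esub> p \<otimes>\<^bsub>G\<^esub> (p \<otimes>\<^bsub>G\<^esub> q) = q"
      using c by (simp_all add: m_assoc[symmetric]) (simp add: m_assoc)
    \<comment> \<open>The identity fills the position between two starred or two unstarred factors;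
      (T1) makes its operator 1.\<close>
    let ?\<alpha> = "[q, \<one>\<^bsub>G\<^esub>, p, p \<otimes>\<^bsub>G\<^esub> q]" and ?\<beta> = "[p \<otimes>\<^bsub>G\<^esub> q, p, \<one>\<^bsub>G\<^esub>, q]"
    have N\<alpha>: "?\<alpha> \<in> ?N" and N\<beta>: "?\<beta> \<in> ?N"
      using p q c val by (auto simp: neutral_words_def words_def)
    have w2: "[p, p \<otimes>\<^bsub>G\<^esub> q] \<in> words P" "[\<one>\<^bsub>G\<^esub>, q] \<in> words P"
      using p q c by (auto simp: words_def)
    have "t \<in> K G P ?\<alpha> \<and> t \<in> K G P ?\<beta>" if t: "t \<in> P" for t
    proof -
      have tc: "t \<in> carrier G"
        using t P by blast
      \<comment> \<open>The last two letters of either word carry t to \<open>q \<otimes> t\<close>,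
        and the whole word carries t to itself; all these points lie in \<open>P\<close>.\<close>
      show ?thesis
        using mem_K_Cons_Cons_iff[OF P words[OF N\<alpha>], of t] mem_K_Cons_Cons_iff[OF P w2(1), of t]
          mem_K_Cons_Cons_iff[OF P words[OF N\<beta>], of t] mem_K_Cons_Cons_iff[OF P w2(2), of t]
          t q tc c val by (auto simp del: K.simps(2))
    qed
    then have "wdot w ?\<alpha> = 1" "wdot w ?\<beta> = 1"
      using K1[OF N\<alpha>] K1[OF N\<beta>] by blast+
    then have a: "adj (w q) * (adj (w p) * w (p \<otimes>\<^bsub>G\<^esub> q)) = 1"
      and b: "adj (w (p \<otimes>\<^bsub>G\<^esub> q)) * (w p * w q) = 1"
      by (simp_all add: T1 adj_one mult.assoc)
    have d: "adj (w q) * (adj (w p) * (w p * w q)) = 1"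
      using isom[OF p] isom[OF q] by (metis mult.assoc mult_1_left)
    let ?d = "w p * w q - w (p \<otimes>\<^bsub>G\<^esub> q)"
    have "adj ?d * ?d = 0"
      using a b d isom[OF c(3)] by (simp add: adj_diff adj_mult algebra_simps)
    then show ?thesis
      by (simp add: adj_mult_self_eq_0_iff)
  qed

  \<comment> \<open>Commuting projections\<close>
  have proj: "is_projection (wdot w \<alpha>)" if \<alpha>: "\<alpha> \<in> ?N" for \<alpha>
  proof -
    have "adj (wdot w \<alpha>) = wdot w \<alpha>"
      using T3[OF rev_in_neutral_words[OF P \<alpha>] \<alpha> K_rev[OF P \<alpha>]] even[OF \<alpha>] by (simp add: wdot_rev)
    moreover have "wdot w \<alpha> * wdot w \<alpha> = wdot w \<alpha>"
      unfolding mult[OF \<alpha>]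
      by (rule T3[OF append_in_neutral_words[OF P \<alpha> \<alpha>] \<alpha>]) (simp add: K_append[OF P \<alpha> \<alpha>])
    ultimately show ?thesis
      by (simp add: is_projection_def)
  qed
  have comm: "wdot w \<alpha> * wdot w \<beta> = wdot w \<beta> * wdot w \<alpha>" if \<alpha>: "\<alpha> \<in> ?N" and \<beta>: "\<beta> \<in> ?N" for \<alpha> \<beta>
    unfolding mult[OF \<alpha>] mult[OF \<beta>]
    by (rule T3) (use K_append[OF P \<alpha> \<beta>] K_append[OF P \<beta> \<alpha>] append_in_neutral_words[OF P] \<alpha> \<beta> in auto)

  \<comment> \<open>Independence of the set of operators from the embedding\<close>
  have zero: "wdot w \<alpha> = 0 \<and> wdot w (\<alpha> @ rev \<alpha>) = 0"
    if \<alpha>: "\<alpha> \<in> words P" and empty: "K G P \<alpha> = {}" for \<alpha>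
  proof -
    have ev: "even (length \<alpha>)"
      using \<alpha> by (rule even_length_if_words)
    have "\<alpha> @ rev \<alpha> \<in> ?N"
      using \<alpha> append_rev_neutral[OF words_mono[OF \<alpha> P]]
      by (auto simp: neutral_words_def intro: append_in_words rev_in_words)
    moreover have "K G P (\<alpha> @ rev \<alpha>) = {}"
      using mem_K_append_iff[OF P \<alpha> rev_in_words[OF \<alpha>]] empty by blast
    ultimately have "wdot w (\<alpha> @ rev \<alpha>) = 0"
      by (rule T2)
    moreover from this have "wdot w \<alpha> = 0"
      using ev by (simp add: wdot_append wdot_rev mult_adj_self_eq_0_iff)
    ultimately show ?thesis by blast
  qed
  have indep: "wdot w ` neutral_words_via H j P = wdot w ` ?N"
    if H: "group H" and j: "j \<in> embeddings G P H" for H :: "('h, 'n) monoid_scheme" and j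
  proof -
    interpret H: group H by fact
    have jP: "j ` P \<subseteq> carrier H"
      using j by (auto simp: embeddings_def mon_def hom_def)
    \<comment> \<open>If \<open>K G P \<alpha>\<close> is empty, \<alpha> may be neutral in only one
      of the groups. Then \<open>\<alpha> @ rev \<alpha>\<close> replaces it: this word is neutral
      in both, and its operator is 0 as well.\<close>
    have rG: "\<alpha> @ rev \<alpha> \<in> ?N" if "\<alpha> \<in> words P" for \<alpha>
      using that append_rev_neutral[OF words_mono[OF that P]]
      by (auto simp: neutral_words_def intro: append_in_words rev_in_words)
    have rH: "\<alpha> @ rev \<alpha> \<in> neutral_words_via H j P" if "\<alpha> \<in> words P" for \<alpha>
      using that H.append_rev_neutral[OF map_in_words[OF that jP]]
      by (auto simp: neutral_words_via_def rev_map intro: append_in_words rev_in_words)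
    have iff: "\<alpha> \<in> neutral_words_via H j P \<longleftrightarrow> \<alpha> \<in> ?N" if "\<alpha> \<in> words P" "K G P \<alpha> \<noteq> {}" for \<alpha>
      using neutral_via_iff[OF P H j that] by (simp add: neutral_words_via_def neutral_words_def)
    show ?thesis
    proof (intro equalityI subsetI)
      fix x
      assume "x \<in> wdot w ` neutral_words_via H j P"
      then obtain \<alpha> where \<alpha>: "\<alpha> \<in> neutral_words_via H j P" "x = wdot w \<alpha>"
        by blast
      then have "\<alpha> \<in> words P"
        by (simp add: neutral_words_via_def)
      then show "x \<in> wdot w ` ?N"
        using \<alpha> zero[of \<alpha>] rG[of \<alpha>] iff[of \<alpha>] by (metis image_eqI)
    next
      fix x
      assume "x \<in> wdot w ` ?N"
      then obtain \<alpha> where "\<alpha> \<in> ?N" "x = wdot w \<alpha>"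
        by blast
      then show "x \<in> wdot w ` neutral_words_via H j P"
        using words[of \<alpha>] zero[of \<alpha>] rH[of \<alpha>] iff[of \<alpha>] by (metis image_eqI)
    qed
  qed

  \<comment> \<open>The inclusion-exclusion formula for neutral words\<close>
  have incl_excl: "wdot w \<alpha> =
      (\<Sum>A\<in>{A. A \<subseteq> F \<and> A \<noteq> {}}. (- 1) ^ (card A + 1) * commuting_prod (wdot w) A)"
    if F: "finite F" "F \<subseteq> ?N" and \<alpha>: "\<alpha> \<in> ?N" and un: "(\<Union>\<beta>\<in>F. K G P \<beta>) = K G P \<alpha>"
      and mem: "K G P \<alpha> \<in> K G P ` F" for F \<alpha>
  proof -
    obtain \<beta> where \<beta>: "\<beta> \<in> F" "K G P \<alpha> = K G P \<beta>"
      using mem by blast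
    have \<beta>N: "\<beta> \<in> ?N"
      using \<beta> F by blast
    have "wdot w \<beta> * wdot w \<gamma> = wdot w \<gamma>" if \<gamma>: "\<gamma> \<in> F" for \<gamma>
    proof -
      have \<gamma>N: "\<gamma> \<in> ?N"
        using \<gamma> F by blast
      \<comment> \<open>\<open>K G P \<gamma>\<close> is part of the union, hence of
        \<open>K G P \<beta>\<close>, so intersecting with the latter changes nothing.\<close>
      have "K G P (\<beta> @ \<gamma>) = K G P \<gamma>"
        using K_append[OF P \<beta>N \<gamma>N] un \<beta> \<gamma> by blast
      then show ?thesis
        unfolding mult[OF \<beta>N] by (rule T3[OF append_in_neutral_words[OF P \<beta>N \<gamma>N] \<gamma>N])
    qed
    moreover have "wdot w \<gamma> * wdot w \<delta> = wdot w \<delta> * wdot w \<gamma>" if "\<gamma> \<in> F" "\<delta> \<in> F" for \<gamma> \<delta>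
      using that F by (intro comm) auto
    ultimately have "(\<Sum>A\<in>{A. A \<subseteq> F \<and> A \<noteq> {}}. (- 1) ^ (card A + 1) * commuting_prod (wdot w) A)
        = wdot w \<beta>"
      using F \<beta> by (intro inclusion_exclusion_dominated)
    \<comment> \<open>(T3) passes from \<beta> to \<alpha>, which need not itself belong to
      \<open>F\<close>.\<close>
    then show ?thesis
      using T3[OF \<alpha> \<beta>N \<beta>(2)] by simp
  qed

  have closed: "wdot w \<alpha> * wdot w \<beta> \<in> wdot w ` ?N" if "\<alpha> \<in> ?N" "\<beta> \<in> ?N" for \<alpha> \<beta>
    unfolding mult[OF that(1)] using append_in_neutral_words[OF P that] by blast
  have one: "1 \<in> wdot w ` ?N"
    using Nil by (metis image_eqI wdot.simps(1))
  show ?thesis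
    unfolding Let_def is_isometry_def
    apply (intro conjI ballI allI impI)
    subgoal by (rule isom)
    subgoal by (rule hom)
    subgoal by (rule indep)
    subgoal using proj by blast
    subgoal using comm by blast
    subgoal using closed by blast
    subgoal by (rule one)
    subgoal by (rule incl_excl)
    done
qed

end
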